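(* Let $f:[0,+\infty)\times\mathbb{R}\to\mathbb{R}$ be continuous with $f(t,0)=0$ for all $t$. Let $v,\lambda:[0,1]\to[0,+\infty)$ be two smooth functions such that $v(0)=\lambda(0)=0$ and $v'(t)>0$, $\lambda(t)>0$ for all $t\in(0,1]$. Assume that $$\frac{\lambda(t)f(t,x)}{v(t)}\to 0\quad\text{and}\quad \frac{f(t,x)}{v'(t)}\to 0\quad\text{as } t\searrow 0,\ \text{uniformly in } |x|\le 1,$$ and that $$|\lambda(t)f(t,x)|\le v(t)\quad\text{for all } t\in[0,1],\ |x|\le 1.$$ Let $$\int_{0+}^{1}\frac{v(w)}{\lambda(w)}\,dw<+\infty .$$ Given a continuous, strictly increasing function $\omega:[0,1]\to[0,+\infty)$, with $\omega(0)=0$, such that $$\int_{0+}^{t}\omega(\varepsilon v(w))\,\frac{dw}{\lambda(w)}\le \varepsilon v(t)\quad\text{for all } \varepsilon>0 \text{ and } t\in(0,1],$$ suppose further that, for $t\in(0,1]$ and $|x|\le 1$, one has $$|f(t,x)|\le\frac{\omega(|x|)}{\lambda(t)}.$$ Then the only solution of the equation $$x'+f(t,x)=0,\quad t>0,$$ starting from $x(0)=0$ is the trivial solution.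
   Context: The equation $x'+f(t,x)=0$ is a scalar nonlinear ordinary differential equation for the unknown $x=x(t)$, and the trivial solution is $x\equiv 0$. The notation $\int_{0+}^{t}$ denotes the integral over $(0,t]$, possibly improper at $0$.
   Formalization: The solution is shown to be trivial only for t in [0,1] (on any interval of existence); for t>1 the claim is false since f is unrestricted there, e.g. f(t,x) = -max(t-1,0)·sqrt|x| with v=λ=t, ω(r)=r has the solution max(t-1,0)^4/16. *)

theory Defs
  imports "HOL-Analysis.Analysis"
begin

(* C^infinity on S. The functions D n are the successive derivatives relative to S, so they are
   one-sided at the endpoints when S is a closed interval and do not depend on g outside S. *)
definition smooth_on :: "real set \<Rightarrow> (real \<Rightarrow> real) \<Rightarrow> bool" where
  "smooth_on S g \<longleftrightarrow>
     (\<exists>D :: nat \<Rightarrow> real \<Rightarrow> real. (\<forall>t\<in>S. D 0 t = g t) \<and>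
        (\<forall>n. \<forall>t\<in>S. (D n has_real_derivative D (Suc n) t) (at t within S)))"

(* x solves x' + f(t,x) = 0 for t > 0, x(0) = 0, on an interval J with left endpoint 0 in J.
   The equation is not imposed at t = 0, where x is only required to be continuous. *)
definition solves_ivp :: "(real \<Rightarrow> real \<Rightarrow> real) \<Rightarrow> real set \<Rightarrow> (real \<Rightarrow> real) \<Rightarrow> bool" where
  "solves_ivp f J x \<longleftrightarrow>
     continuous_on J x \<and> x 0 = 0 \<and>
     (\<forall>t\<in>J. t > 0 \<longrightarrow>
        (\<exists>x'. (x has_real_derivative x') (at t within J) \<and> x' + f t (x t) = 0))"

end

theory Submission
  imports Defs
begin

text \<open>
  The limit \<open>f / v' \<rightarrow> 0\<close> makes \<open>\<bar>x\<bar> / v\<close> tend to \<open>0\<close> at the origin. If \<open>x\<close> is not trivial, this ratio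
  therefore has a positive maximum \<open>M\<close>, attained at some \<open>T > 0\<close>, and \<open>\<bar>x\<bar> \<le> M v\<close> holds with strict
  inequality near \<open>0\<close>. As \<open>\<omega>\<close> is strictly increasing, the integral condition with \<open>\<epsilon> = M\<close> yields
  \<open>M v(T) = \<bar>x(T)\<bar> \<le> \<integral> \<omega>(\<bar>x\<bar>) / \<lambda> < \<integral> \<omega>(M v) / \<lambda> \<le> M v(T)\<close>, the integrals being over \<open>(0, T]\<close>.
\<close>

text \<open>Both \<open>G - y\<close> and \<open>G + y\<close> have positive derivative, hence
  increase strictly. Derivatives are asked for in the open interval only, so that the comparison can
  start at the time 0, where the equation is not imposed.\<close>

lemma DERIV_abs_less_imp_abs_diff_less:
  fixes y G :: "real \<Rightarrow> real"
  assumes "a < b" and "continuous_on {a..b} y" and "continuous_on {a..b} G"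
    and der: "\<And>s. a < s \<Longrightarrow> s < b \<Longrightarrow>
      \<exists>y' G'. (y has_real_derivative y') (at s) \<and> (G has_real_derivative G') (at s) \<and> \<bar>y'\<bar> < G'"
  shows "\<bar>y b - y a\<bar> < G b - G a"
proof -
  have "(\<lambda>s. G s - y s) a < (\<lambda>s. G s - y s) b"
  proof (rule DERIV_pos_imp_increasing_open[OF \<open>a < b\<close>])
    fix s assume "a < s" "s < b"
    from der[OF this] obtain y' G' where "(y has_real_derivative y') (at s)"
      "(G has_real_derivative G') (at s)" "\<bar>y'\<bar> < G'" by blast
    then show "\<exists>D. ((\<lambda>s. G s - y s) has_real_derivative D) (at s) \<and> 0 < D"
      by (intro exI[of _ "G' - y'"] conjI DERIV_diff) auto
  qed (intro continuous_intros assms)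
  moreover have "(\<lambda>s. G s + y s) a < (\<lambda>s. G s + y s) b"
  proof (rule DERIV_pos_imp_increasing_open[OF \<open>a < b\<close>])
    fix s assume "a < s" "s < b"
    from der[OF this] obtain y' G' where "(y has_real_derivative y') (at s)"
      "(G has_real_derivative G') (at s)" "\<bar>y'\<bar> < G'" by blast
    then show "\<exists>D. ((\<lambda>s. G s + y s) has_real_derivative D) (at s) \<and> 0 < D"
      by (intro exI[of _ "G' + y'"] conjI DERIV_add) auto
  qed (intro continuous_intros assms)
  ultimately show ?thesis by linarith
qed

text \<open>Reduction to the strict case: an extra slope \<open>k\<close> makes the inequality of
  derivatives strict and raises the increment of \<open>G\<close> by exactly \<open>e\<close>, which
  is arbitrary.\<close>

lemma DERIV_abs_le_imp_abs_diff_le: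
  fixes y G :: "real \<Rightarrow> real"
  assumes "a \<le> b" and "continuous_on {a..b} y" and "continuous_on {a..b} G"
    and der: "\<And>s. a < s \<Longrightarrow> s < b \<Longrightarrow>
      \<exists>y' G'. (y has_real_derivative y') (at s) \<and> (G has_real_derivative G') (at s) \<and> \<bar>y'\<bar> \<le> G'"
  shows "\<bar>y b - y a\<bar> \<le> G b - G a"
proof (cases "a = b")
  case False
  then have "a < b" using \<open>a \<le> b\<close> by simp
  show ?thesis
  proof (rule field_le_epsilon)
    fix e :: real assume "e > 0"
    define k where "k = e / (b - a)"
    have "k > 0" using \<open>e > 0\<close> \<open>a < b\<close> by (simp add: k_def)
    have "\<bar>y b - y a\<bar> < (\<lambda>s. G s + k * s) b - (\<lambda>s. G s + k * s) a"
    proof (rule DERIV_abs_less_imp_abs_diff_less[OF \<open>a < b\<close>])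
      fix s assume "a < s" "s < b"
      from der[OF this] obtain y' G' where d: "(y has_real_derivative y') (at s)"
        "(G has_real_derivative G') (at s)" "\<bar>y'\<bar> \<le> G'" by blast
      have "((\<lambda>s. G s + k * s) has_real_derivative G' + k) (at s)"
        by (auto intro!: derivative_eq_intros d)
      with d \<open>k > 0\<close> show "\<exists>y' G'. (y has_real_derivative y') (at s) \<and>
          ((\<lambda>s. G s + k * s) has_real_derivative G') (at s) \<and> \<bar>y'\<bar> < G'"
        by (intro exI[of _ y'] exI[of _ "G' + k"]) auto
    qed (intro continuous_intros assms)+
    also have "(\<lambda>s. G s + k * s) b - (\<lambda>s. G s + k * s) a = G b - G a + k * (b - a)"
      by (simp add: algebra_simps)
    also have "k * (b - a) = e" using \<open>a < b\<close> by (simp add: k_def)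
    finally show "\<bar>y b - y a\<bar> \<le> G b - G a + e" by simp
  qed
qed simp

text \<open>The comparison function is the primitive of \<open>g\<close>. Continuity of
  \<open>g\<close> on a closed interval is assumed, so the use below is on intervals with positive
  left end.\<close>

lemma
  fixes y g :: "real \<Rightarrow> real"
  assumes "continuous_on {a..b} y" and g: "continuous_on {a..b} g"
    and y': "\<And>s. a < s \<Longrightarrow> s < b \<Longrightarrow> (y has_real_derivative y' s) (at s)"
  shows abs_diff_le_integral:
      "\<lbrakk>a \<le> b; \<And>s. a < s \<Longrightarrow> s < b \<Longrightarrow> \<bar>y' s\<bar> \<le> g s\<rbrakk> \<Longrightarrow> \<bar>y b - y a\<bar> \<le> integral {a..b} g"
    and abs_diff_less_integral:
      "\<lbrakk>a < b; \<And>s. a < s \<Longrightarrow> s < b \<Longrightarrow> \<bar>y' s\<bar> < g s\<rbrakk> \<Longrightarrow> \<bar>y b - y a\<bar> < integral {a..b} g"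
proof -
  define G where "G = (\<lambda>t. integral {a..t} g)"
  have G_within: "(G has_real_derivative g s) (at s within {a..b})" if "s \<in> {a..b}" for s
    unfolding G_def by (rule integral_has_real_derivative[OF g that])
  have G_cont: "continuous_on {a..b} G"
    using G_within by (rule DERIV_continuous_on)
  have G': "(G has_real_derivative g s) (at s)" if "a < s" "s < b" for s
    using G_within[of s] that by (simp add: at_within_Icc_at)
  have G_a: "G a = 0" by (simp add: G_def)
  {
    assume "a \<le> b" "\<And>s. a < s \<Longrightarrow> s < b \<Longrightarrow> \<bar>y' s\<bar> \<le> g s"
    then have "\<bar>y b - y a\<bar> \<le> G b - G a"
      using y' G' by (intro DERIV_abs_le_imp_abs_diff_le assms G_cont) blast+
    with G_a show "\<bar>y b - y a\<bar> \<le> integral {a..b} g" by (simp add: G_def)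
  }
  {
    assume "a < b" "\<And>s. a < s \<Longrightarrow> s < b \<Longrightarrow> \<bar>y' s\<bar> < g s"
    then have "\<bar>y b - y a\<bar> < G b - G a"
      using y' G' by (intro DERIV_abs_less_imp_abs_diff_less assms G_cont) blast+
    with G_a show "\<bar>y b - y a\<bar> < integral {a..b} g" by (simp add: G_def)
  }
qed

text \<open>Link between the two integrals in use: the condition on \<open>\<omega>\<close> bounds a
  Lebesgue integral over a set with 0 as a limit point, while increments are bounded by gauge
  integrals over compact subintervals. For a nonnegative integrand, shrinking the domain only lowers
  the value.\<close>

lemma integral_le_nn_integral_bound:
  fixes g :: "real \<Rightarrow> real"
  assumes g: "continuous_on {a..b} g" and nonneg: "\<And>s. s \<in> {a..b} \<Longrightarrow> 0 \<le> g s"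
    and "{a..b} \<subseteq> S" and bound: "(\<integral>\<^sup>+s\<in>S. ennreal (g s) \<partial>lborel) \<le> ennreal C" and "0 \<le> C"
  shows "integral {a..b} g \<le> C"
proof -
  have "ennreal (integral {a..b} g) = (\<integral>\<^sup>+s\<in>{a..b}. ennreal (g s) \<partial>lborel)"
    using nonneg integrable_integral[OF integrable_continuous_interval[OF g]]
    by (intro nn_integral_has_integral_lebesgue'[symmetric]) auto
  also have "\<dots> \<le> (\<integral>\<^sup>+s\<in>S. ennreal (g s) \<partial>lborel)"
    using \<open>{a..b} \<subseteq> S\<close> by (intro nn_integral_mono) (auto simp: indicator_def)
  finally show ?thesis using bound \<open>0 \<le> C\<close> by (metis ennreal_le_iff order_trans)
qed

text \<open>The times in \<open>{a..b}\<close> with value at least \<open>m\<close> form a compact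
  set, and \<open>c\<close> is its least element. The intermediate value theorem gives a time
  \<open>r \<le> c\<close> with value exactly \<open>m\<close>, and minimality forces
  \<open>r = c\<close>. It serves to cut a solution before it leaves the range where
  \<open>f\<close> is controlled.\<close>

lemma first_hitting_time:
  fixes x :: "real \<Rightarrow> real"
  assumes x: "continuous_on {a..b} x" and "a \<le> b" and "x a < m" and "m \<le> x b"
  obtains c where "a < c" "c \<le> b" "x c = m" "\<And>s. s \<in> {a..c} \<Longrightarrow> x s \<le> m"
proof -
  define S where "S = {s \<in> {a..b}. m \<le> x s}"
  have "closed S" unfolding S_def
    by (intro continuous_on_closed_Collect_le x continuous_on_const closed_atLeastAtMost)
  moreover have "bounded S"
    by (rule bounded_subset[OF bounded_closed_interval[of a b]]) (auto simp: S_def)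
  ultimately have "compact S" by (simp add: compact_eq_bounded_closed)
  moreover have "b \<in> S" using assms by (simp add: S_def)
  ultimately obtain c where c: "c \<in> S" "\<And>s. s \<in> S \<Longrightarrow> c \<le> s"
    using compact_attains_inf[of S] by blast
  have "continuous_on {a..c} x"
    using x by (rule continuous_on_subset) (use c in \<open>auto simp: S_def\<close>)
  then obtain r where r: "a \<le> r" "r \<le> c" "x r = m"
    using IVT'[of x a m c] c \<open>x a < m\<close> by (auto simp: S_def)
  then have "r \<in> S" using c by (auto simp: S_def)
  then have "x c = m" using r c(2)[of r] by simp
  show thesis
  proof
    have "a \<noteq> c" using \<open>x c = m\<close> \<open>x a < m\<close> by fastforce
    then show "a < c" using \<open>c \<in> S\<close> by (simp add: S_def)
    show "c \<le> b" using \<open>c \<in> S\<close> by (simp add: S_def)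
    show "x c = m" by fact
    fix s assume s: "s \<in> {a..c}"
    show "x s \<le> m"
    proof (rule ccontr)
      assume "\<not> x s \<le> m"
      moreover from this have "s \<in> S" using s \<open>c \<in> S\<close> by (simp add: S_def)
      then have "s = c" using c(2)[of s] s by simp
      ultimately show False using \<open>x c = m\<close> by simp
    qed
  qed
qed

lemma at_right_0_small_ratio:
  fixes f :: "real \<Rightarrow> real \<Rightarrow> real"
  assumes lim: "uniform_limit X (\<lambda>t x. f t x / p t) (\<lambda>_. 0) (at_right 0)"
    and "0 < e" and "0 < a" and p: "\<And>t. t \<in> {0<..a} \<Longrightarrow> 0 < p t"
  obtains d where "0 < d" "d \<le> a" "\<And>t x. 0 < t \<Longrightarrow> t < d \<Longrightarrow> x \<in> X \<Longrightarrow> \<bar>f t x\<bar> \<le> e * p t"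
proof -
  have "\<forall>\<^sub>F t in at_right 0. \<forall>x\<in>X. \<bar>f t x / p t\<bar> < e"
    using uniform_limitD[OF lim \<open>0 < e\<close>] by simp
  then obtain d where d: "0 < d" "\<And>t x. 0 < t \<Longrightarrow> t < d \<Longrightarrow> x \<in> X \<Longrightarrow> \<bar>f t x / p t\<bar> < e"
    unfolding eventually_at_right_field by blast
  show thesis
  proof
    fix t x assume t: "0 < t" "t < min d a" "x \<in> X"
    then have "0 < p t" using p by simp
    then show "\<bar>f t x\<bar> \<le> e * p t" using d(2)[of t x] t by (simp add: field_simps)
  qed (use d \<open>0 < a\<close> in auto)
qed

text \<open>Values near 0 lie below \<open>q t\<close>, so the maximum over a compact interval that
  contains \<open>t\<close> and everything beyond \<open>d\<close> is a maximum over the whole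
  half-open interval.\<close>

lemma attains_max_if_small_at_left_end:
  fixes q :: "real \<Rightarrow> real"
  assumes q: "continuous_on {0<..b} q" and t: "0 < t" "t \<le> b"
    and d: "0 < d" and small: "\<And>s. 0 < s \<Longrightarrow> s \<le> d \<Longrightarrow> q s < q t"
  obtains T where "T \<in> {0<..b}" "\<And>s. s \<in> {0<..b} \<Longrightarrow> q s \<le> q T" "q t \<le> q T"
proof -
  define K where "K = {min d t..b}"
  have "continuous_on K q"
    using q by (rule continuous_on_subset) (use t d in \<open>auto simp: K_def\<close>)
  moreover have "t \<in> K" "compact K" using t by (auto simp: K_def)
  ultimately obtain T where T: "T \<in> K" "\<And>s. s \<in> K \<Longrightarrow> q s \<le> q T"
    using continuous_attains_sup[of K q] by blast
  show thesis
  proof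
    show "T \<in> {0<..b}" using T t d by (auto simp: K_def)
    show "q t \<le> q T" using T \<open>t \<in> K\<close> by blast
    fix s assume s: "s \<in> {0<..b}"
    show "q s \<le> q T"
    proof (cases "s \<le> d")
      case True
      then show ?thesis using small[of s] s T(2)[OF \<open>t \<in> K\<close>] by auto
    next
      case False
      then show ?thesis using s by (intro T) (auto simp: K_def)
    qed
  qed
qed

(* The integrands are nonnegative and continuous on (0,1], so the possibly improper integrals
   over (0,t] are nonnegative Lebesgue integrals. As \<omega> is given on [0,1] only, its integral
   condition is required for those \<epsilon> and t for which the argument \<epsilon> * v w stays in [0,1].
   The hypotheses constrain f(t,x) for t \<le> 1 only, so a solution on an interval J, which may
   reach beyond 1, is claimed to vanish on J \<inter> [0,1]. *)
theorem theorem1: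
  fixes f :: "real \<Rightarrow> real \<Rightarrow> real"
    and v v' lam \<omega> :: "real \<Rightarrow> real"
  assumes f_cont: "continuous_on ({0..} \<times> UNIV) (\<lambda>(t, x). f t x)"
    and f_zero: "\<forall>t\<ge>0. f t 0 = 0"
    and v_smooth: "smooth_on {0..1} v"
    and lam_smooth: "smooth_on {0..1} lam"
    and v_nonneg: "\<forall>t\<in>{0..1}. v t \<ge> 0"
    and lam_nonneg: "\<forall>t\<in>{0..1}. lam t \<ge> 0"
    and v_deriv: "\<forall>t\<in>{0..1}. (v has_real_derivative v' t) (at t within {0..1})"
    and v_0: "v 0 = 0"
    and lam_0: "lam 0 = 0"
    and v'_pos: "\<forall>t\<in>{0<..1}. v' t > 0"
    and lam_pos: "\<forall>t\<in>{0<..1}. lam t > 0"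
    and lim_v: "uniform_limit {x. \<bar>x\<bar> \<le> 1} (\<lambda>t x. lam t * f t x / v t) (\<lambda>_. 0) (at_right 0)"
    and lim_v': "uniform_limit {x. \<bar>x\<bar> \<le> 1} (\<lambda>t x. f t x / v' t) (\<lambda>_. 0) (at_right 0)"
    and bound_v: "\<forall>t\<in>{0..1}. \<forall>x. \<bar>x\<bar> \<le> 1 \<longrightarrow> \<bar>lam t * f t x\<bar> \<le> v t"
    and int_finite: "(\<integral>\<^sup>+w\<in>{0<..1}. ennreal (v w / lam w) \<partial>lborel) < \<infinity>"
    and \<omega>_cont: "continuous_on {0..1} \<omega>"
    and \<omega>_mono: "strict_mono_on {0..1} \<omega>"
    and \<omega>_nonneg: "\<forall>r\<in>{0..1}. \<omega> r \<ge> 0"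
    and \<omega>_0: "\<omega> 0 = 0"
    and \<omega>_int: "\<forall>\<epsilon>>0. \<forall>t\<in>{0<..1}. (\<forall>w\<in>{0<..t}. \<epsilon> * v w \<in> {0..1}) \<longrightarrow>
          (\<integral>\<^sup>+w\<in>{0<..t}. ennreal (\<omega> (\<epsilon> * v w) * (1 / lam w)) \<partial>lborel) \<le> ennreal (\<epsilon> * v t)"
    and bound_\<omega>: "\<forall>t\<in>{0<..1}. \<forall>x. \<bar>x\<bar> \<le> 1 \<longrightarrow> \<bar>f t x\<bar> \<le> \<omega> \<bar>x\<bar> / lam t"
  shows "\<forall>J. is_interval J \<and> 0 \<in> J \<and> J \<subseteq> {0..} \<longrightarrow>
           solves_ivp f J (\<lambda>_. 0) \<and>
           (\<forall>x. solves_ivp f J x \<longrightarrow> (\<forall>t\<in>J \<inter> {0..1}. x t = 0))"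
proof -

  \<comment> \<open>Regularity and monotonicity of the data\<close>
  have v_cont: "continuous_on {0..1} v"
    using v_deriv by (intro DERIV_continuous_on) auto
  have lam_cont: "continuous_on {0..1} lam"
  proof -
    obtain D where D: "\<forall>t\<in>{0..1}. D 0 t = lam t"
      "\<forall>n. \<forall>t\<in>{0..1}. (D n has_real_derivative D (Suc n) t) (at t within {0..1})"
      using lam_smooth unfolding smooth_on_def by blast
    have "continuous_on {0..1} (D 0)"
      by (rule DERIV_continuous_on[where D = "D (Suc 0)"]) (use D(2) in blast)
    then show ?thesis by (rule continuous_on_eq) (use D(1) in simp)
  qed
  have v_der: "(v has_real_derivative v' t) (at t)" if "0 < t" "t < 1" for t
    using v_deriv that by (auto simp: at_within_Icc_at dest!: bspec[of _ _ t])
  have v_less: "v s < v t" if "0 \<le> s" "s < t" "t \<le> 1" for s t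
  proof (rule DERIV_pos_imp_increasing_open[OF \<open>s < t\<close>])
    show "\<exists>y. (v has_real_derivative y) (at r) \<and> 0 < y" if "s < r" "r < t" for r
      using v_der[of r] v'_pos that \<open>0 \<le> s\<close> \<open>t \<le> 1\<close> by (intro exI[of _ "v' r"]) auto
    show "continuous_on {s..t} v"
      using v_cont by (rule continuous_on_subset) (use that in auto)
  qed
  have v_pos: "0 < v t" if "0 < t" "t \<le> 1" for t
    using v_less[of 0 t] v_0 that by simp
  have \<omega>_less: "\<omega> r < \<omega> s" if "0 \<le> r" "r < s" "s \<le> 1" for r s
    using \<omega>_mono that by (auto simp: strict_mono_on_def)

  \<comment> \<open>The core contradiction, for a solution that stays in [-1,1] up to time
    \<open>b\<close>, since only there is \<open>f\<close> controlled.\<close>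
  have no_escape: False
    if x_cont: "continuous_on {0..b} x" and x0: "x 0 = 0" and b: "0 < b" "b \<le> 1" and xb: "x b \<noteq> 0"
      and x1: "\<And>t. t \<in> {0..b} \<Longrightarrow> \<bar>x t\<bar> \<le> 1"
      and x': "\<And>t. 0 < t \<Longrightarrow> t < b \<Longrightarrow> (x has_real_derivative - f t (x t)) (at t)"
    for x :: "real \<Rightarrow> real" and b
  proof -

    \<comment> \<open>The maximum of the ratio of \<open>\<bar>x\<bar>\<close> to
      \<open>v\<close>\<close>
    have x_cont_sub: "continuous_on {s..t} x" if "0 \<le> s" "t \<le> b" for s t
      using x_cont by (rule continuous_on_subset) (use that in auto)
    define q where "q t = \<bar>x t\<bar> / v t" for t
    have qb: "0 < q b" using xb v_pos b by (simp add: q_def)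
    \<comment> \<open>The factor \<open>q b / 2\<close> keeps the ratio at most half of its value at
      \<open>b\<close> near 0, so the maximum is attained away from 0.\<close>
    obtain d where d: "0 < d" "d \<le> b" and
      fd: "\<And>t x. 0 < t \<Longrightarrow> t < d \<Longrightarrow> x \<in> {x. \<bar>x\<bar> \<le> 1} \<Longrightarrow> \<bar>f t x\<bar> \<le> q b / 2 * v' t"
      by (rule at_right_0_small_ratio[OF lim_v', of "q b / 2" b]) (use qb v'_pos b in auto)
    have small: "q t < q b" if t: "0 < t" "t \<le> d" for t
    proof -
      have "\<bar>x t - x 0\<bar> \<le> (\<lambda>t. q b / 2 * v t) t - (\<lambda>t. q b / 2 * v t) 0"
      proof (rule DERIV_abs_le_imp_abs_diff_le)
        show "continuous_on {0..t} (\<lambda>t. q b / 2 * v t)"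
          using v_cont by (intro continuous_intros continuous_on_subset[OF v_cont]) (use t d b in auto)
        fix s assume s: "0 < s" "s < t"
        then have "(x has_real_derivative - f s (x s)) (at s)" using x' t d by simp
        moreover have "((\<lambda>t. q b / 2 * v t) has_real_derivative q b / 2 * v' s) (at s)"
          using s t d b by (intro DERIV_cmult v_der) auto
        moreover have "\<bar>- f s (x s)\<bar> \<le> q b / 2 * v' s"
          using fd[of s "x s"] x1[of s] s t d by simp
        ultimately show "\<exists>y' G'. (x has_real_derivative y') (at s) \<and>
            ((\<lambda>t. q b / 2 * v t) has_real_derivative G') (at s) \<and> \<bar>y'\<bar> \<le> G'" by blast
      qed (use t d x_cont_sub in auto)
      then have "\<bar>x t\<bar> \<le> q b / 2 * v t" using x0 v_0 by simp
      moreover have "0 < v t" using v_pos t d b by simp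
      ultimately have "q t \<le> q b / 2" by (simp add: q_def field_simps)
      then show ?thesis using qb by simp
    qed
    have q_cont: "continuous_on {0<..b} q"
    proof -
      have "continuous_on {0<..b} x" "continuous_on {0<..b} v"
        using b by (auto intro: continuous_on_subset[OF x_cont] continuous_on_subset[OF v_cont])
      moreover have "v s \<noteq> 0" if "s \<in> {0<..b}" for s using v_pos[of s] that b by simp
      ultimately show ?thesis unfolding q_def by (intro continuous_on_divide continuous_on_rabs) auto
    qed
    obtain T where T: "T \<in> {0<..b}" and max: "\<And>s. s \<in> {0<..b} \<Longrightarrow> q s \<le> q T" and "q b \<le> q T"
      using attains_max_if_small_at_left_end[OF q_cont b(1) order_refl d(1) small] by blast
    define M where "M = q T"
    have M: "0 < M" using qb \<open>q b \<le> q T\<close> by (simp add: M_def)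
    have xT: "\<bar>x T\<bar> = M * v T" using v_pos[of T] T b by (simp add: M_def q_def)
    have MvT: "M * v T \<le> 1" using xT x1[of T] T by simp
    \<comment> \<open>The integral condition for \<open>\<epsilon> = M\<close> is available only
      while \<open>M * v s\<close> stays in [0,1]. This holds because \<open>v\<close> increases and
      \<open>M * v T\<close> equals \<open>\<bar>x T\<bar>\<close>.\<close>
    have Mv: "M * v s \<in> {0..1}" if "0 \<le> s" "s \<le> T" for s
    proof -
      have "M * v s \<le> M * v T"
        using M that T b v_less[of s T] by (cases "s = T") auto
      moreover have "0 \<le> M * v s" using M v_nonneg that T b by auto
      ultimately show ?thesis using MvT by simp
    qed
    have x_le: "\<bar>x s\<bar> \<le> M * v s" if "0 < s" "s \<le> T" for s
      using max[of s] v_pos[of s] that T b by (simp add: M_def q_def field_simps)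
    have x_less: "\<bar>x s\<bar> < M * v s" if "0 < s" "s \<le> T" "s \<le> d" for s
    proof -
      have "q s < M" using small[of s] \<open>q b \<le> q T\<close> that by (simp add: M_def)
      moreover have "0 < v s" using v_pos that T b by simp
      ultimately show ?thesis by (simp add: q_def pos_divide_less_eq)
    qed

    \<comment> \<open>The majorant \<open>g\<close> of the derivative of the solution\<close>
    define g where "g s = \<omega> (M * v s) * (1 / lam s)" for s
    have f_le: "\<bar>- f s (x s)\<bar> \<le> g s" if s: "0 < s" "s \<le> T" for s
    proof -
      have "\<bar>f s (x s)\<bar> \<le> \<omega> \<bar>x s\<bar> / lam s" using bound_\<omega> x1[of s] s T b by auto
      also have "\<dots> \<le> \<omega> (M * v s) / lam s"
      proof (rule divide_right_mono)
        show "\<omega> \<bar>x s\<bar> \<le> \<omega> (M * v s)"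
          using x_le[OF s] Mv[of s] \<omega>_less[of "\<bar>x s\<bar>" "M * v s"] s
          by (cases "\<bar>x s\<bar> = M * v s") auto
        show "0 \<le> lam s" using lam_nonneg s T b by auto
      qed
      finally show ?thesis by (simp add: g_def)
    qed
    \<comment> \<open>Up to time \<open>d\<close> the ratio is strictly below \<open>M\<close>, and
      strict monotonicity of \<open>\<omega>\<close> carries the strictness over to the
      derivative.\<close>
    have f_less: "\<bar>- f s (x s)\<bar> < g s" if s: "0 < s" "s \<le> T" "s \<le> d" for s
    proof -
      have "\<bar>f s (x s)\<bar> \<le> \<omega> \<bar>x s\<bar> / lam s" using bound_\<omega> x1[of s] s T b by auto
      also have "\<dots> < \<omega> (M * v s) / lam s"
        using x_less[OF s] Mv[of s] lam_pos s T b by (intro divide_strict_right_mono \<omega>_less) auto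
      finally show ?thesis by (simp add: g_def)
    qed
    have g_cont: "continuous_on {s..t} g" if "0 < s" "t \<le> T" for s t
    proof -
      have *: "continuous_on {s..t} (\<lambda>s. \<omega> (M * v s))"
      proof (rule continuous_on_compose2[OF \<omega>_cont])
        show "continuous_on {s..t} (\<lambda>s. M * v s)"
          by (intro continuous_intros continuous_on_subset[OF v_cont]) (use that T b in auto)
        show "(\<lambda>s. M * v s) ` {s..t} \<subseteq> {0..1}" using Mv that by auto
      qed
      have "continuous_on {s..t} lam"
        using lam_cont by (rule continuous_on_subset) (use that T b in auto)
      moreover have "\<forall>r\<in>{s..t}. lam r \<noteq> 0"
        using lam_pos that T b by (metis atLeastAtMost_iff greaterThanAtMost_iff less_irrefl less_le_trans order_trans)
      ultimately show ?thesis unfolding g_def by (intro continuous_intros *)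
    qed
    \<comment> \<open>The integral condition with \<open>\<epsilon> = M\<close>. The bound does not
      depend on \<open>s\<close>, so the left end can later tend to 0.\<close>
    have g_bound: "integral {s..T} g \<le> M * v T" if "0 < s" for s
    proof (rule integral_le_nn_integral_bound[where S = "{0<..T}"])
      show "(\<integral>\<^sup>+w\<in>{0<..T}. ennreal (g w) \<partial>lborel) \<le> ennreal (M * v T)"
        unfolding g_def using \<omega>_int M T b Mv by auto
      show "0 \<le> g r" if "r \<in> {s..T}" for r
        using f_le[of r] that \<open>0 < s\<close> by auto
    qed (use that Mv[of T] T g_cont in auto)
    have xg_le: "\<bar>x t - x s\<bar> \<le> integral {s..t} g" if "0 < s" "s \<le> t" "t \<le> T" for s t
      by (rule abs_diff_le_integral[where y' = "\<lambda>s. - f s (x s)"])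
        (use that T x' f_le x_cont_sub g_cont in auto)

    \<comment> \<open>The strict gain near 0 and the contradiction\<close>
    define h where "h = min d T"
    \<comment> \<open>On \<open>{h/2..h}\<close> the majorant is strict and continuous, so the
      estimate of the increment there has a positive slack \<open>c\<close>, fixed before the left
      end \<open>a\<close> is chosen.\<close>
    define c where "c = integral {h/2..h} g - \<bar>x h - x (h/2)\<bar>"
    have h: "0 < h" "h \<le> d" "h \<le> T" using d T by (auto simp: h_def)
    have "\<bar>x h - x (h/2)\<bar> < integral {h/2..h} g"
      by (rule abs_diff_less_integral[where y' = "\<lambda>s. - f s (x s)"])
        (use h T x' f_less x_cont_sub g_cont in auto)
    then have "0 < c" by (simp add: c_def)
    \<comment> \<open>Split \<open>{a..T}\<close> at \<open>h/2\<close> and \<open>h\<close>: the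
      outer increments are at most their integrals, the middle one falls short by \<open>c\<close>.
      Hence \<open>\<bar>x T\<bar> - \<bar>x a\<bar>\<close> is at most \<open>M * v T - c\<close>,
      which is \<open>\<bar>x T\<bar> - c\<close>.\<close>
    have x_lower: "c \<le> \<bar>x a\<bar>" if a: "0 < a" "a < h/2" for a
    proof -
      have g_int: "g integrable_on {s..t}" if "0 < s" "t \<le> T" for s t
        using g_cont[OF that] by (rule integrable_continuous_interval)
      have "integral {a..h/2} g + integral {h/2..T} g = integral {a..T} g"
        using a h by (intro Henstock_Kurzweil_Integration.integral_combine g_int) auto
      moreover have "integral {h/2..h} g + integral {h..T} g = integral {h/2..T} g"
        using a h by (intro Henstock_Kurzweil_Integration.integral_combine g_int) auto
      moreover have "integral {a..T} g \<le> M * v T" using g_bound a by simp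
      ultimately show ?thesis
        using xg_le[of a "h/2"] xg_le[of h T] a h xT unfolding c_def by linarith
    qed
    \<comment> \<open>Continuity at 0 with \<open>x 0 = 0\<close> contradicts the lower bound
      \<open>c\<close> as \<open>a\<close> tends to 0.\<close>
    have "(x \<longlongrightarrow> x 0) (at 0 within {0..b})"
      using x_cont b by (auto simp: continuous_on_def)
    then have x_lim: "(x \<longlongrightarrow> 0) (at_right 0)"
      using b x0 by (simp add: at_within_Icc_at_right)
    have "\<forall>\<^sub>F a in at_right 0. \<bar>x a\<bar> < c"
      using tendstoD[OF x_lim \<open>0 < c\<close>] by simp
    moreover have "\<forall>\<^sub>F a in at_right 0. a \<in> {0<..<h/2}"
      using h by (intro eventually_at_right_real) simp
    ultimately have "\<forall>\<^sub>F a in at_right (0::real). False"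
      by eventually_elim (use x_lower in force)
    then show False by (simp add: trivial_limit_at_right_real)
  qed

  \<comment> \<open>Transfer to solutions on an arbitrary interval \<open>J\<close>\<close>
  show ?thesis
  proof (intro allI impI conjI ballI; elim conjE)
    fix J :: "real set" assume J: "is_interval J" "0 \<in> J" "J \<subseteq> {0..}"
    show "solves_ivp f J (\<lambda>_. 0)"
      unfolding solves_ivp_def using f_zero by (auto intro!: exI[of _ 0])
    fix x t assume x: "solves_ivp f J x" and t: "t \<in> J \<inter> {0..1}"
    have J_sub: "{0..t} \<subseteq> J"
      using J(1,2) t unfolding is_interval_1 by (meson IntD1 atLeastAtMost_iff subsetI)
    have x_cont: "continuous_on {0..t} x" and x0: "x 0 = 0"
      using x J_sub by (auto simp: solves_ivp_def intro: continuous_on_subset)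
    have x': "(x has_real_derivative - f s (x s)) (at s)" if s: "0 < s" "s < t" for s
    proof -
      have "s \<in> J" using J_sub s by auto
      then obtain D where D: "(x has_real_derivative D) (at s within J)" "D + f s (x s) = 0"
        using x s by (auto simp: solves_ivp_def)
      have "s \<in> interior J"
      proof (rule interiorI)
        show "open {0<..<t}" "s \<in> {0<..<t}" "{0<..<t} \<subseteq> J" using J_sub s by auto
      qed
      then have "at s within J = at s" by (rule at_within_interior)
      moreover have "D = - f s (x s)" using D(2) by linarith
      ultimately show ?thesis using D(1) by metis
    qed
    show "x t = 0"
    proof (rule ccontr)
      assume "x t \<noteq> 0"
      \<comment> \<open>The cap 1 keeps the solution in the controlled range until level
        \<open>m\<close> is hit. The cap \<open>\<bar>x t\<bar>\<close> ensures that the level is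
        hit by time \<open>t\<close>.\<close>
      define m where "m = min 1 \<bar>x t\<bar>"
      have m: "0 < m" "m \<le> 1" "m \<le> \<bar>x t\<bar>" using \<open>x t \<noteq> 0\<close> by (auto simp: m_def)
      obtain b where b: "0 < b" "b \<le> t" "\<bar>x b\<bar> = m" "\<And>s. s \<in> {0..b} \<Longrightarrow> \<bar>x s\<bar> \<le> m"
        using first_hitting_time[of 0 t "\<lambda>s. \<bar>x s\<bar>" m] x_cont x0 m t
        by (auto intro: continuous_intros)
      show False
      proof (rule no_escape[of b x])
        show "continuous_on {0..b} x"
          using x_cont by (rule continuous_on_subset) (use b in auto)
        show "\<bar>x s\<bar> \<le> 1" if "s \<in> {0..b}" for s using b(4)[OF that] m by linarith
        show "(x has_real_derivative - f s (x s)) (at s)" if "0 < s" "s < b" for s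
          using x' that b by simp
      qed (use b m t x0 in auto)
    qed
  qed
qed

end
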